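(* Let $n\ge d\ge2$ and consider linear dynamics $\dot X=\alpha_0X$ with a single scalar parameter $\alpha_0\in\mathbb{R}$, fixed initial state $X(0)\in\mathbb{R}^{n\times d}$, $P(t)=X(t)X(t)^\top$ with $0<P_{ij}(t)<1$, and snapshots indexed $t=0,\dots,T$. Then the Fisher information for $\alpha_0$ is $$\mathcal{I}(\alpha_0)=4\sum_{t=0}^Tt^2\sum_{i<j}\frac{P_{ij}(t)}{1-P_{ij}(t)}.$$ This scales as $\Theta(T^3n^2)$ when edge probabilities remain bounded away from $0$ and $1$ throughout the trajectory (i.e. for fixed $\epsilon>0$ there are constants $c,C>0$ depending only on $\epsilon$ such that $P_{ij}(t)\in[\epsilon,1-\epsilon]$ for all $i<j$ and all $t=0,\dots,T$, $T\ge1$, implies $cT^3n^2\le\mathcal{I}(\alpha_0)\le CT^3n^2$), giving a Cramér–Rao lower bound $\operatorname{Var}(\hat\alpha_0)\ge\mathcal{I}(\alpha_0)^{-1}=\Omega(1/(T^3n^2))$ for unbiased estimators $\hat\alpha_0$.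
   Context: Data: for $t=0,\dots,T$ and $1\le i<j\le n$, $A^{(t)}_{ij}\sim\mathrm{Bernoulli}(P_{ij}(t))$, all independent, where $P(t)=P(t;\alpha_0)$. The Fisher information of the sample is $\mathcal{I}(\alpha_0)=\sum_{t=0}^T\sum_{i<j}\big(\frac{\partial P_{ij}(t)}{\partial\alpha_0}\big)^2\frac{1}{P_{ij}(t)(1-P_{ij}(t))}$. The parameter ranges over an open set on which all $P_{ij}(t;\alpha_0)\in(0,1)$, and an estimator is unbiased if its expectation equals $\alpha_0$ for all parameter values in that set. *)

theory Defs
  imports "HOL-Probability.Probability" "Jordan_Normal_Form.Matrix"
begin

text \<open>Vertices are numbered \<open>0..<n\<close>.\<close>

definition edge_pairs :: "nat \<Rightarrow> (nat \<times> nat) set" where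
  "edge_pairs n = {(i, j). i < j \<and> j < n}"

text \<open>\<open>X\<close> solves \<open>dX/ds = a X\<close>, \<open>X 0 = X0\<close> on \<open>{0..\<tau>}\<close> in the space of \<open>n \<times> d\<close> matrices.
  The derivative is taken entrywise and is one-sided at the end points.\<close>

definition linear_trajectory ::
    "nat \<Rightarrow> nat \<Rightarrow> real \<Rightarrow> real mat \<Rightarrow> real \<Rightarrow> (real \<Rightarrow> real mat) \<Rightarrow> bool" where
  "linear_trajectory n d \<tau> X0 a X \<longleftrightarrow>
     X 0 = X0 \<and>
     (\<forall>s\<in>{0..\<tau>}. X s \<in> carrier_mat n d \<and>
        (\<forall>i<n. \<forall>k<d. ((\<lambda>r. X r $$ (i, k)) has_real_derivative (a \<cdot>\<^sub>m X s) $$ (i, k))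
                         (at s within {0..\<tau>})))"

text \<open>In the following, \<open>X a s\<close> is the state at time \<open>s\<close> under parameter value \<open>a\<close>, and
  \<open>P a t\<close> is the matrix of edge probabilities of snapshot \<open>t\<close>.\<close>

definition edge_prob :: "(real \<Rightarrow> real \<Rightarrow> real mat) \<Rightarrow> real \<Rightarrow> nat \<Rightarrow> real mat" where
  "edge_prob X a t = X a (real t) * transpose_mat (X a (real t))"

definition linear_model ::
    "nat \<Rightarrow> nat \<Rightarrow> nat \<Rightarrow> real mat \<Rightarrow> real set \<Rightarrow> (real \<Rightarrow> real \<Rightarrow> real mat) \<Rightarrow> bool" where
  "linear_model n d T X0 \<Theta> X \<longleftrightarrow>
     2 \<le> d \<and> d \<le> n \<and> X0 \<in> carrier_mat n d \<and> open \<Theta> \<and>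
     (\<forall>a\<in>\<Theta>. linear_trajectory n d (real T) X0 a (X a)) \<and>
     (\<forall>a\<in>\<Theta>. \<forall>t\<le>T. \<forall>(i, j)\<in>edge_pairs n.
        0 < edge_prob X a t $$ (i, j) \<and> edge_prob X a t $$ (i, j) < 1)"

definition fisher_info :: "nat \<Rightarrow> nat \<Rightarrow> (real \<Rightarrow> nat \<Rightarrow> real mat) \<Rightarrow> real \<Rightarrow> real" where
  "fisher_info n T P a =
     (\<Sum>t=0..T. \<Sum>(i, j)\<in>edge_pairs n.
        (deriv (\<lambda>b. P b t $$ (i, j)) a)\<^sup>2 * (1 / (P a t $$ (i, j) * (1 - P a t $$ (i, j)))))"

text \<open>Joint law of all the independent edge indicators; an outcome \<open>A\<close> has
  \<open>A (t, i, j) = True\<close> iff edge \<open>(i, j)\<close> is present in snapshot \<open>t\<close>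
  (the value outside the index set is irrelevantly fixed to \<open>False\<close>).\<close>

definition sample_law ::
    "nat \<Rightarrow> nat \<Rightarrow> (real \<Rightarrow> nat \<Rightarrow> real mat) \<Rightarrow> real \<Rightarrow> (nat \<times> nat \<times> nat \<Rightarrow> bool) pmf" where
  "sample_law n T P a =
     Pi_pmf ({0..T} \<times> edge_pairs n) False (\<lambda>(t, i, j). bernoulli_pmf (P a t $$ (i, j)))"

definition unbiased_estimator ::
    "(real \<Rightarrow> 'a pmf) \<Rightarrow> real set \<Rightarrow> ('a \<Rightarrow> real) \<Rightarrow> bool" where
  "unbiased_estimator law \<Theta> est \<longleftrightarrow>
     (\<forall>a\<in>\<Theta>. measure_pmf.expectation (law a) est = a)"

end

theory Submission imports Defs begin

text \<open>The trajectory is \<open>X a s = exp (a s) X0\<close>, so each edge probability is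
  \<open>exp (2 a t) P 0\<close> with logarithmic derivative \<open>2 t\<close> in \<open>a\<close>. Differentiating the normalisation
  and the unbiasedness identity shows that the covariance of the estimator with the score is
  \<open>1\<close>, and the Cauchy--Schwarz inequality bounds its variance below by the inverse second
  moment of the score. The score is a sum of independent centred Bernoulli scores, so this second
  moment is the Fisher information.\<close>

section \<open>Cramer-Rao inequality for finitely supported laws and for products of Bernoulli
  laws\<close>

text \<open>The score enters only through the derivative of the mass function, written as mass times
  score; this avoids logarithms and tolerates outcomes of mass zero. The finite set \<open>S\<close>
  contains the support for every parameter in \<Theta>, so expectations are finite sums over a fixed
  set and can be differentiated termwise. The product form of the conclusion needs no positivity of
  the information, and in fact forces it.\<close>

lemma cramer_rao_score:
  fixes law :: "real \<Rightarrow> 'a pmf"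
  assumes fin: "finite S" and supp: "\<And>b. b \<in> \<Theta> \<Longrightarrow> set_pmf (law b) \<subseteq> S"
    and \<Theta>: "open \<Theta>" "a \<in> \<Theta>"
    and deriv: "\<And>x. x \<in> S \<Longrightarrow>
      ((\<lambda>b. pmf (law b) x) has_real_derivative pmf (law a) x * score x) (at a)"
    and unbiased: "unbiased_estimator law \<Theta> est"
  shows "1 \<le> measure_pmf.expectation (law a) (\<lambda>x. (score x)\<^sup>2) * measure_pmf.variance (law a) est"
proof -
  have expect: "measure_pmf.expectation (law b) f = (\<Sum>x\<in>S. f x * pmf (law b) x)"
    if "b \<in> \<Theta>" for b and f :: "'a \<Rightarrow> real"
    using supp[OF that] by (intro integral_measure_pmf_real fin) auto
  have deriv_expect: "((\<lambda>b. \<Sum>x\<in>S. f x * pmf (law b) x) has_real_derivative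
      (\<Sum>x\<in>S. f x * (pmf (law a) x * score x))) (at a)" for f
    by (intro derivative_intros deriv DERIV_cmult)
  \<comment> \<open>Total mass is the constant 1 on the open set \<Theta> only, which suffices for
    the derivative at \<open>a\<close>.\<close>
  have "((\<lambda>b. \<Sum>x\<in>S. 1 * pmf (law b) x) has_real_derivative 0) (at a)"
  proof (rule has_field_derivative_transform_within_open[OF _ \<Theta>])
    show "((\<lambda>_. 1) has_real_derivative 0) (at a)" by simp
    show "1 = (\<Sum>x\<in>S. 1 * pmf (law b) x)" if "b \<in> \<Theta>" for b
      using expect[OF that, of "\<lambda>_. 1"] by simp
  qed
  then have mean_score: "(\<Sum>x\<in>S. pmf (law a) x * score x) = 0"
    using DERIV_unique[OF deriv_expect[of "\<lambda>_. 1"]] by simp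
  have "((\<lambda>b. \<Sum>x\<in>S. est x * pmf (law b) x) has_real_derivative 1) (at a)"
  proof (rule has_field_derivative_transform_within_open[OF _ \<Theta>])
    show "((\<lambda>b. b) has_real_derivative 1) (at a)" by simp
    show "b = (\<Sum>x\<in>S. est x * pmf (law b) x)" if "b \<in> \<Theta>" for b
      using unbiased that expect[OF that, of est] by (simp add: unbiased_estimator_def)
  qed
  then have "(\<Sum>x\<in>S. est x * (pmf (law a) x * score x)) = 1"
    using DERIV_unique[OF deriv_expect[of est]] by simp
  \<comment> \<open>Since the score has mean zero, the estimator may be centred at \<open>a\<close>;
    the sum then becomes a covariance.\<close>
  with mean_score have "(\<Sum>x\<in>S. (est x - a) * (pmf (law a) x * score x)) = 1"
    by (simp add: left_diff_distrib sum_subtractf flip: sum_distrib_left)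
  also have "(\<Sum>x\<in>S. (est x - a) * (pmf (law a) x * score x)) =
      (\<Sum>x\<in>S. (score x * sqrt (pmf (law a) x)) * ((est x - a) * sqrt (pmf (law a) x)))"
  proof (rule sum.cong[OF refl])
    have regroup: "u * (r * r * v) = (v * r) * (u * r)" for r u v :: real
      by (simp only: mult_ac)
    show "(est x - a) * (pmf (law a) x * score x) =
        (score x * sqrt (pmf (law a) x)) * ((est x - a) * sqrt (pmf (law a) x))" for x
      using regroup[of "est x - a" "sqrt (pmf (law a) x)" "score x"] by simp
  qed
  finally have "1 = (\<Sum>x\<in>S. (score x * sqrt (pmf (law a) x)) * ((est x - a) * sqrt (pmf (law a) x)))\<^sup>2"
    by simp
  also have "\<dots> \<le> (\<Sum>x\<in>S. (score x * sqrt (pmf (law a) x))\<^sup>2) *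
      (\<Sum>x\<in>S. ((est x - a) * sqrt (pmf (law a) x))\<^sup>2)"
    by (rule Cauchy_Schwarz_ineq_sum)
  also have "\<dots> = measure_pmf.expectation (law a) (\<lambda>x. (score x)\<^sup>2) *
      measure_pmf.expectation (law a) (\<lambda>x. (est x - a)\<^sup>2)"
    by (simp add: expect[OF \<Theta>(2)] power_mult_distrib)
  \<comment> \<open>Unbiasedness at \<open>a\<close> turns the second moment about \<open>a\<close>
    into the variance.\<close>
  finally show ?thesis
    using unbiased \<Theta>(2) by (simp add: unbiased_estimator_def)
qed

text \<open>Expanding the square leaves only the diagonal: a mixed term factors by independence into
  two means, both zero. This is the additivity of Fisher information over independent
  observations.\<close>

lemma expectation_Pi_pmf_sum_power2:
  fixes s :: "'i \<Rightarrow> 'b \<Rightarrow> real"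
  assumes fin: "finite A" "\<And>i. i \<in> A \<Longrightarrow> finite (set_pmf (p i))"
    and centred: "\<And>i. i \<in> A \<Longrightarrow> measure_pmf.expectation (p i) (s i) = 0"
  shows "measure_pmf.expectation (Pi_pmf A d p) (\<lambda>f. (\<Sum>i\<in>A. s i (f i))\<^sup>2) =
    (\<Sum>i\<in>A. measure_pmf.expectation (p i) (\<lambda>x. (s i x)\<^sup>2))"
proof -
  let ?M = "Pi_pmf A d p"
  have "finite (set_pmf ?M)"
    using fin by (auto simp: set_Pi_pmf)
  then have int: "integrable (measure_pmf ?M) f" for f :: "_ \<Rightarrow> real"
    by (rule integrable_measure_pmf_finite)
  have marginal: "measure_pmf.expectation ?M (\<lambda>f. g (f i)) = measure_pmf.expectation (p i) g"
    if "i \<in> A" for i and g :: "'b \<Rightarrow> real"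
  proof -
    have "measure_pmf.expectation ?M (\<lambda>f. g (f i)) =
        measure_pmf.expectation (map_pmf (\<lambda>f. f i) ?M) g" by simp
    then show ?thesis using fin that by (simp only: Pi_pmf_component if_True)
  qed
  have cross: "measure_pmf.expectation ?M (\<lambda>f. s i (f i) * s j (f j)) = 0"
    if "i \<in> A" "j \<in> A" "i \<noteq> j" for i j
  proof -
    have "prob_space.indep_vars ?M (\<lambda>_. borel) (\<lambda>k f. s k (f k)) {i, j}"
    proof (rule prob_space.indep_vars_compose2[OF measure_pmf.prob_space_axioms,
          where X = "\<lambda>k f. f k" and Y = s])
      show "prob_space.indep_vars ?M (\<lambda>_. count_space UNIV) (\<lambda>k f. f k) {i, j}"
        using that by (intro prob_space.indep_vars_subset[OF measure_pmf.prob_space_axioms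
            indep_vars_Pi_pmf[OF fin(1)]]) auto
    qed simp
    then have "measure_pmf.expectation ?M (\<lambda>f. \<Prod>k\<in>{i, j}. s k (f k)) =
        (\<Prod>k\<in>{i, j}. measure_pmf.expectation ?M (\<lambda>f. s k (f k)))"
      by (intro prob_space.indep_vars_lebesgue_integral[OF measure_pmf.prob_space_axioms] int) simp_all
    then show ?thesis using that marginal centred by simp
  qed
  have "measure_pmf.expectation ?M (\<lambda>f. (\<Sum>i\<in>A. s i (f i))\<^sup>2) =
      (\<Sum>i\<in>A. \<Sum>j\<in>A. measure_pmf.expectation ?M (\<lambda>f. s i (f i) * s j (f j)))"
    by (simp add: power2_eq_square sum_product int)
  also have "\<dots> = (\<Sum>i\<in>A. \<Sum>j\<in>A. if i = j
      then measure_pmf.expectation (p i) (\<lambda>x. (s i x)\<^sup>2) else 0)"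
    using cross marginal[where g = "\<lambda>x. (s _ x)\<^sup>2"]
    by (intro sum.cong refl) (auto simp: power2_eq_square)
  finally show ?thesis using fin(1) by simp
qed

text \<open>The logarithmic derivative of a product is the sum of those of its factors, so the score
  of the joint law is a sum of one-coordinate scores, whose second moment is additive.\<close>

lemma cramer_rao_Pi_bernoulli:
  fixes q :: "real \<Rightarrow> 'i \<Rightarrow> real"
  assumes A: "finite A" and \<Theta>: "open \<Theta>" "a \<in> \<Theta>"
    and q: "\<And>b i. b \<in> \<Theta> \<Longrightarrow> i \<in> A \<Longrightarrow> 0 < q b i \<and> q b i < 1"
    and deriv: "\<And>i. i \<in> A \<Longrightarrow> ((\<lambda>b. q b i) has_real_derivative q' i) (at a)"
    and unbiased: "unbiased_estimator (\<lambda>b. Pi_pmf A False (\<lambda>i. bernoulli_pmf (q b i))) \<Theta> est"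
  shows "1 \<le> (\<Sum>i\<in>A. (q' i)\<^sup>2 * (1 / (q a i * (1 - q a i)))) *
    measure_pmf.variance (Pi_pmf A False (\<lambda>i. bernoulli_pmf (q a i))) est"
proof -
  define law where "law b = Pi_pmf A False (\<lambda>i. bernoulli_pmf (q b i))" for b
  \<comment> \<open>The logarithmic derivative at \<open>a\<close> of the Bernoulli mass: of
    \<open>q\<close> on success and of \<open>1 - q\<close> on failure.\<close>
  define s where "s i x = (if x then q' i / q a i else - q' i / (1 - q a i))" for i x
  have qa: "0 < q a i" "q a i < 1" if "i \<in> A" for i
    using q[OF \<Theta>(2) that] by auto
  have bernoulli_deriv: "((\<lambda>b. pmf (bernoulli_pmf (q b i)) x) has_real_derivative
      pmf (bernoulli_pmf (q a i)) x * s i x) (at a)" if "i \<in> A" for i x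
  \<comment> \<open>The case formula for the Bernoulli mass is available only when
    \<open>q b i\<close> is a probability, hence the restriction to \<Theta>.\<close>
  proof (rule has_field_derivative_transform_within_open[OF _ \<Theta>])
    show "((\<lambda>b. if x then q b i else 1 - q b i) has_real_derivative
        pmf (bernoulli_pmf (q a i)) x * s i x) (at a)"
      using qa[OF that] deriv[OF that] by (cases x) (auto intro!: derivative_eq_intros simp: s_def)
    show "(if x then q b i else 1 - q b i) = pmf (bernoulli_pmf (q b i)) x" if "b \<in> \<Theta>" for b
      using q[OF that \<open>i \<in> A\<close>] by (cases x) auto
  qed
  have "1 \<le> measure_pmf.expectation (law a) (\<lambda>f. (\<Sum>i\<in>A. s i (f i))\<^sup>2) *
      measure_pmf.variance (law a) est"
  proof (rule cramer_rao_score[OF _ _ \<Theta>])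
    show "finite (PiE_dflt A False (\<lambda>_. UNIV :: bool set))"
      using A by auto
    show "set_pmf (law b) \<subseteq> PiE_dflt A False (\<lambda>_. UNIV)" for b
      using set_Pi_pmf_subset'[OF A] by (fastforce simp: law_def PiE_dflt_def)
    show "unbiased_estimator law \<Theta> est"
      using unbiased by (simp add: law_def[abs_def])
    fix f assume f: "f \<in> PiE_dflt A False (\<lambda>_. UNIV :: bool set)"
    then have law_f: "pmf (law b) f = (\<Prod>i\<in>A. pmf (bernoulli_pmf (q b i)) (f i))" for b
      using A unfolding law_def by (intro pmf_Pi') (auto simp: PiE_dflt_def)
    \<comment> \<open>The logarithmic product rule below divides by every factor.\<close>
    have nz: "pmf (bernoulli_pmf (q a i)) x \<noteq> 0" if "i \<in> A" for i x
      using qa[OF that] by (cases x) auto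
    have "((\<lambda>b. \<Prod>i\<in>A. pmf (bernoulli_pmf (q b i)) (f i)) has_real_derivative
        (\<Prod>i\<in>A. pmf (bernoulli_pmf (q a i)) (f i)) *
        (\<Sum>i\<in>A. pmf (bernoulli_pmf (q a i)) (f i) * s i (f i) / pmf (bernoulli_pmf (q a i)) (f i))) (at a)"
      using nz bernoulli_deriv by (intro has_field_derivative_prod') auto
    also have "(\<Sum>i\<in>A. pmf (bernoulli_pmf (q a i)) (f i) * s i (f i) / pmf (bernoulli_pmf (q a i)) (f i)) =
        (\<Sum>i\<in>A. s i (f i))"
      using nz by (intro sum.cong) auto
    finally show "((\<lambda>b. pmf (law b) f) has_real_derivative pmf (law a) f * (\<Sum>i\<in>A. s i (f i))) (at a)"
      by (simp add: law_f)
  qed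
  also have "measure_pmf.expectation (law a) (\<lambda>f. (\<Sum>i\<in>A. s i (f i))\<^sup>2) =
      (\<Sum>i\<in>A. measure_pmf.expectation (bernoulli_pmf (q a i)) (\<lambda>x. (s i x)\<^sup>2))"
    unfolding law_def
  proof (rule expectation_Pi_pmf_sum_power2[OF A])
    show "measure_pmf.expectation (bernoulli_pmf (q a i)) (s i) = 0" if "i \<in> A" for i
      using qa[OF that] by (simp add: s_def)
  qed simp
  also have "\<dots> = (\<Sum>i\<in>A. (q' i)\<^sup>2 * (1 / (q a i * (1 - q a i))))"
  proof (rule sum.cong[OF refl])
    fix i assume "i \<in> A"
    note qa = qa[OF this]
    have square_mult: "(x / y)\<^sup>2 * y = x\<^sup>2 * (1 / y)" if "0 < y" for x y :: real
      using that by (simp add: power2_eq_square)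
    \<comment> \<open>The two outcomes, weighted by their probabilities, contribute the reciprocals
      of \<open>q\<close> and \<open>1 - q\<close>, which add up to the reciprocal of their
      product.\<close>
    have "(q' i / q a i)\<^sup>2 * q a i + (- q' i / (1 - q a i))\<^sup>2 * (1 - q a i) =
        (q' i)\<^sup>2 * (1 / q a i + 1 / (1 - q a i))"
      using qa by (simp only: square_mult distrib_left power2_minus diff_gt_0_iff_gt)
    also have "1 / q a i + 1 / (1 - q a i) = 1 / (q a i * (1 - q a i))"
      using qa by (simp add: field_simps)
    finally show "measure_pmf.expectation (bernoulli_pmf (q a i)) (\<lambda>x. (s i x)\<^sup>2) =
        (q' i)\<^sup>2 * (1 / (q a i * (1 - q a i)))"
      using qa by (simp add: s_def)
  qed
  finally show ?thesis by (simp add: law_def)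
qed

section \<open>Counting edges and summing squares\<close>

lemma finite_edge_pairs: "finite (edge_pairs n)"
  by (rule finite_subset[of _ "{..<n} \<times> {..<n}"]) (auto simp: edge_pairs_def)

lemma card_edge_pairs: "2 * card (edge_pairs n) = n * (n - 1)"
proof -
  \<comment> \<open>Pairs are grouped by their larger endpoint \<open>j\<close>, which has
    \<open>j\<close> possible partners.\<close>
  have "edge_pairs n = (SIGMA j:{..<n}. {..<j})\<inverse>"
    by (auto simp: edge_pairs_def)
  then have "card (edge_pairs n) = (\<Sum>j<n. j)"
    by simp
  \<comment> \<open>Evenness makes the natural-number division in the formula for the sum
    exact.\<close>
  moreover have "even (n * (n - 1))"
    by (cases n) auto
  ultimately show ?thesis
    by (simp add: lessThan_atLeast0 Sum_Ico_nat)
qed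

lemma card_edge_pairs_bounds:
  assumes "2 \<le> n"
  shows "(real n)\<^sup>2 / 4 \<le> real (card (edge_pairs n))" "real (card (edge_pairs n)) \<le> (real n)\<^sup>2"
proof -
  have "2 * real (card (edge_pairs n)) = real n * (real n - 1)"
    using arg_cong[OF card_edge_pairs[of n], of real] assms by (simp add: of_nat_diff)
  moreover have "real n * 2 \<le> real n * real n"
    using assms by (intro mult_left_mono) auto
  ultimately show "(real n)\<^sup>2 / 4 \<le> real (card (edge_pairs n))"
      "real (card (edge_pairs n)) \<le> (real n)\<^sup>2"
    by (auto simp: power2_eq_square algebra_simps)
qed

text \<open>By induction: the new term \<open>(T + 1)^2\<close> lies between the increments of
  \<open>T^3 / 3\<close> and of \<open>T^3\<close>.\<close>

lemma sum_squares_bounds: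
  "real T ^ 3 / 3 \<le> (\<Sum>t=0..T. (real t)\<^sup>2)" "(\<Sum>t=0..T. (real t)\<^sup>2) \<le> real T ^ 3"
proof -
  have "real T ^ 3 / 3 \<le> (\<Sum>t=0..T. (real t)\<^sup>2) \<and> (\<Sum>t=0..T. (real t)\<^sup>2) \<le> real T ^ 3"
  proof (induction T)
    case (Suc T)
    have "real T \<le> real (Suc T) * (real T)" "0 \<le> real T ^ 2"
      by (auto simp: algebra_simps)
    then have "real (Suc T) ^ 3 / 3 \<le> real T ^ 3 / 3 + (real (Suc T))\<^sup>2"
      "real T ^ 3 + (real (Suc T))\<^sup>2 \<le> real (Suc T) ^ 3"
      by (simp_all add: power2_eq_square power3_eq_cube algebra_simps)
    with Suc show ?case by simp
  qed simp
  then show "real T ^ 3 / 3 \<le> (\<Sum>t=0..T. (real t)\<^sup>2)" "(\<Sum>t=0..T. (real t)\<^sup>2) \<le> real T ^ 3"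
    by auto
qed

section \<open>Closed form of the linear model and the size of its Fisher information\<close>

text \<open>Uniqueness by an integrating factor: multiplying an entry by
  \<open>exp (- (a * r))\<close> gives a function with zero derivative on the interval, whose
  constant value is read off at time 0.\<close>

lemma linear_trajectory_exp:
  assumes traj: "linear_trajectory n d \<tau> X0 a X" and s: "s \<in> {0..\<tau>}"
  shows "X s = exp (a * s) \<cdot>\<^sub>m X0"
proof (rule eq_matI)
  have zero: "0 \<in> {0..\<tau>}" using s by auto
  have carrier: "X r \<in> carrier_mat n d" if "r \<in> {0..\<tau>}" for r
    using traj that by (auto simp: linear_trajectory_def)
  have X0: "X 0 = X0" "X0 \<in> carrier_mat n d"
    using traj carrier[OF zero] by (auto simp: linear_trajectory_def)
  show "dim_row (X s) = dim_row (exp (a * s) \<cdot>\<^sub>m X0)" "dim_col (X s) = dim_col (exp (a * s) \<cdot>\<^sub>m X0)"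
    using carrier[OF s] X0 by auto
  fix i k assume "i < dim_row (exp (a * s) \<cdot>\<^sub>m X0)" "k < dim_col (exp (a * s) \<cdot>\<^sub>m X0)"
  then have ik: "i < n" "k < d" using X0 by auto
  have "\<exists>c. \<forall>r\<in>{0..\<tau>}. exp (- (a * r)) * X r $$ (i, k) = c"
  proof (rule has_field_derivative_zero_constant)
    fix r assume r: "r \<in> {0..\<tau>}"
    then have "((\<lambda>r. X r $$ (i, k)) has_real_derivative (a \<cdot>\<^sub>m X r) $$ (i, k)) (at r within {0..\<tau>})"
      using traj ik by (simp add: linear_trajectory_def)
    also have "(a \<cdot>\<^sub>m X r) $$ (i, k) = a * X r $$ (i, k)"
      using ik carrier[OF r] by simp
    finally have "((\<lambda>r. X r $$ (i, k)) has_real_derivative a * X r $$ (i, k)) (at r within {0..\<tau>})" .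
    then show "((\<lambda>r. exp (- (a * r)) * X r $$ (i, k)) has_real_derivative 0) (at r within {0..\<tau>})"
      by (auto intro!: derivative_eq_intros)
  qed simp
  then have "exp (- (a * s)) * X s $$ (i, k) = exp (- (a * 0)) * X 0 $$ (i, k)"
    using s zero by metis
  then show "X s $$ (i, k) = (exp (a * s) \<cdot>\<^sub>m X0) $$ (i, k)"
    using ik X0 by (simp add: exp_minus field_simps)
qed

text \<open>Both factors of the Gram matrix carry the same scalar \<open>exp (b * t)\<close>, which
  accounts for the 2 in the exponent.\<close>

lemma linear_model_edge_prob:
  assumes model: "linear_model n d T X0 \<Theta> X" and "b \<in> \<Theta>" "t \<le> T" "(i, j) \<in> edge_pairs n"
  shows "edge_prob X b t $$ (i, j) = exp (2 * b * real t) * (X0 * transpose_mat X0) $$ (i, j)"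
proof -
  have X0: "X0 \<in> carrier_mat n d" and traj: "linear_trajectory n d (real T) X0 b (X b)"
    using assms by (auto simp: linear_model_def)
  have X: "X b (real t) = exp (b * real t) \<cdot>\<^sub>m X0"
    using assms by (intro linear_trajectory_exp[OF traj]) auto
  have "i < n" "j < n"
    using assms by (auto simp: edge_pairs_def)
  then have "edge_prob X b t $$ (i, j) =
      exp (b * real t) * exp (b * real t) * (X0 * transpose_mat X0) $$ (i, j)"
    using X0 by (simp add: edge_prob_def X scalar_prod_def sum_distrib_left mult_ac)
  then show ?thesis by (simp flip: exp_add)
qed

text \<open>The closed form is known only for parameters in \<Theta>; openness lets its derivative
  pass to the model.\<close>

lemma linear_model_edge_prob_deriv:
  assumes model: "linear_model n d T X0 \<Theta> X" and a: "a \<in> \<Theta>" and t: "t \<le> T" "(i, j) \<in> edge_pairs n"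
  shows "((\<lambda>b. edge_prob X b t $$ (i, j)) has_real_derivative
    2 * real t * edge_prob X a t $$ (i, j)) (at a)"
proof (rule has_field_derivative_transform_within_open)
  show "((\<lambda>b. exp (2 * b * real t) * (X0 * transpose_mat X0) $$ (i, j)) has_real_derivative
      2 * real t * edge_prob X a t $$ (i, j)) (at a)"
    by (auto intro!: derivative_eq_intros simp: linear_model_edge_prob[OF model a t])
  show "open \<Theta>" using model by (simp add: linear_model_def)
qed (use a linear_model_edge_prob[OF model _ t] in auto)

lemma linear_model_edge_prob_bounds:
  assumes "linear_model n d T X0 \<Theta> X" "a \<in> \<Theta>" "t \<le> T" "(i, j) \<in> edge_pairs n"
  shows "0 < edge_prob X a t $$ (i, j)" "edge_prob X a t $$ (i, j) < 1"
  using assms by (force simp: linear_model_def)+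

text \<open>With derivative \<open>2 * t * P\<close>, one power of \<open>P\<close> cancels against
  the Bernoulli variance \<open>P * (1 - P)\<close>, leaving the odds times
  \<open>4 * t^2\<close>.\<close>

lemma fisher_info_linear_model:
  assumes model: "linear_model n d T X0 \<Theta> X" and a: "a \<in> \<Theta>"
  shows "fisher_info n T (edge_prob X) a =
    4 * (\<Sum>t=0..T. (real t)\<^sup>2 * (\<Sum>(i, j)\<in>edge_pairs n.
      edge_prob X a t $$ (i, j) / (1 - edge_prob X a t $$ (i, j))))"
  unfolding fisher_info_def sum_distrib_left
proof (intro sum.cong refl, clarify)
  fix t i j assume "t \<in> {0..T}" "(i, j) \<in> edge_pairs n"
  then have t: "t \<le> T" "(i, j) \<in> edge_pairs n" by auto
  show "(deriv (\<lambda>b. edge_prob X b t $$ (i, j)) a)\<^sup>2 *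
      (1 / (edge_prob X a t $$ (i, j) * (1 - edge_prob X a t $$ (i, j)))) =
      4 * ((real t)\<^sup>2 * (edge_prob X a t $$ (i, j) / (1 - edge_prob X a t $$ (i, j))))"
    using linear_model_edge_prob_bounds[OF model a t]
    by (simp add: DERIV_imp_deriv[OF linear_model_edge_prob_deriv[OF model a t]] power2_eq_square)
qed

text \<open>The odds of every edge lie between \<epsilon> and its reciprocal. The lower constant is
  the product of 4, 1/3 from the sum of squares, 1/4 from the edge count and \<epsilon>; for the
  upper one, both counting factors are 1.\<close>

lemma fisher_info_linear_model_bounds:
  assumes model: "linear_model n d T X0 \<Theta> X" and a: "a \<in> \<Theta>" and \<epsilon>: "0 < \<epsilon>"
    and P: "\<forall>t\<le>T. \<forall>(i, j)\<in>edge_pairs n. edge_prob X a t $$ (i, j) \<in> {\<epsilon>..1 - \<epsilon>}"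
  shows "\<epsilon> / 3 * real T ^ 3 * (real n)\<^sup>2 \<le> fisher_info n T (edge_prob X) a"
    and "fisher_info n T (edge_prob X) a \<le> 4 / \<epsilon> * real T ^ 3 * (real n)\<^sup>2"
proof -
  define odds where "odds t = (\<Sum>(i, j)\<in>edge_pairs n.
    edge_prob X a t $$ (i, j) / (1 - edge_prob X a t $$ (i, j)))" for t
  have n: "2 \<le> n" using model by (simp add: linear_model_def)
  have fisher: "fisher_info n T (edge_prob X) a = 4 * (\<Sum>t=0..T. (real t)\<^sup>2 * odds t)"
    using fisher_info_linear_model[OF model a] by (simp add: odds_def)
  have odds: "\<epsilon> * ((real n)\<^sup>2 / 4) \<le> odds t \<and> odds t \<le> 1 / \<epsilon> * (real n)\<^sup>2" if t: "t \<le> T" for t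
  proof -
    have edge: "\<epsilon> \<le> p / (1 - p)" "p / (1 - p) \<le> 1 / \<epsilon>" if "\<epsilon> \<le> p" "p \<le> 1 - \<epsilon>" for p :: real
    proof -
      have "p * (1 - p) \<le> p * 1"
        using that \<epsilon> by (intro mult_left_mono) auto
      then have "p \<le> p / (1 - p)"
        using that \<epsilon> by (simp add: pos_le_divide_eq)
      with that show "\<epsilon> \<le> p / (1 - p)" by simp
      show "p / (1 - p) \<le> 1 / \<epsilon>"
        using that \<epsilon> by (intro frac_le) auto
    qed
    have "real (card (edge_pairs n)) * \<epsilon> \<le> odds t"
      unfolding odds_def using P t by (intro sum_bounded_below) (auto intro!: edge)
    moreover have "odds t \<le> real (card (edge_pairs n)) * (1 / \<epsilon>)"
      unfolding odds_def using P t by (intro sum_bounded_above) (auto intro!: edge)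
    moreover have "(real n)\<^sup>2 / 4 * \<epsilon> \<le> real (card (edge_pairs n)) * \<epsilon>"
      "real (card (edge_pairs n)) * (1 / \<epsilon>) \<le> (real n)\<^sup>2 * (1 / \<epsilon>)"
      using card_edge_pairs_bounds[OF n] \<epsilon> by (auto intro!: mult_right_mono divide_right_mono)
    ultimately show ?thesis by (simp add: mult.commute)
  qed
  have "real T ^ 3 / 3 * (\<epsilon> * ((real n)\<^sup>2 / 4)) \<le> (\<Sum>t=0..T. (real t)\<^sup>2) * (\<epsilon> * ((real n)\<^sup>2 / 4))"
    using \<epsilon> by (intro mult_right_mono sum_squares_bounds) auto
  also have "\<dots> \<le> (\<Sum>t=0..T. (real t)\<^sup>2 * odds t)"
    unfolding sum_distrib_right using odds by (intro sum_mono mult_left_mono) auto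
  finally show "\<epsilon> / 3 * real T ^ 3 * (real n)\<^sup>2 \<le> fisher_info n T (edge_prob X) a"
    by (simp add: fisher mult_ac)
  have "(\<Sum>t=0..T. (real t)\<^sup>2 * odds t) \<le> (\<Sum>t=0..T. (real t)\<^sup>2) * (1 / \<epsilon> * (real n)\<^sup>2)"
    unfolding sum_distrib_right using odds by (intro sum_mono mult_left_mono) auto
  also have "\<dots> \<le> real T ^ 3 * (1 / \<epsilon> * (real n)\<^sup>2)"
    using \<epsilon> by (intro mult_right_mono sum_squares_bounds) auto
  finally show "fisher_info n T (edge_prob X) a \<le> 4 / \<epsilon> * real T ^ 3 * (real n)\<^sup>2"
    by (simp add: fisher mult_ac)
qed

section \<open>Variance bounds in the linear model\<close>

lemma cramer_rao_linear_model:
  assumes model: "linear_model n d T X0 \<Theta> X" and a: "a \<in> \<Theta>"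
    and unbiased: "unbiased_estimator (sample_law n T (edge_prob X)) \<Theta> est"
  shows "0 < fisher_info n T (edge_prob X) a"
    and "inverse (fisher_info n T (edge_prob X) a) \<le>
      measure_pmf.variance (sample_law n T (edge_prob X) a) est"
proof -
  let ?I = "fisher_info n T (edge_prob X) a"
  let ?V = "measure_pmf.variance (sample_law n T (edge_prob X) a) est"
  define A where "A = {0..T} \<times> edge_pairs n"
  \<comment> \<open>The double sum over snapshots and edges is flattened to one index set of
    triples, matching the coordinates of the sample.\<close>
  define q where "q b = (\<lambda>(t, i, j). edge_prob X b t $$ (i, j))" for b
  define q' where "q' = (\<lambda>(t, i, j). 2 * real t * edge_prob X a t $$ (i, j))"
  have law: "sample_law n T (edge_prob X) b = Pi_pmf A False (\<lambda>i. bernoulli_pmf (q b i))" for b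
    unfolding sample_law_def A_def q_def by (intro arg_cong[where f = "Pi_pmf _ _"]) auto
  have "?I = (\<Sum>t=0..T. \<Sum>(i, j)\<in>edge_pairs n. (q' (t, i, j))\<^sup>2 *
      (1 / (q a (t, i, j) * (1 - q a (t, i, j)))))"
    unfolding fisher_info_def
    by (intro sum.cong refl)
      (auto simp: q_def q'_def DERIV_imp_deriv[OF linear_model_edge_prob_deriv[OF model a]])
  also have "\<dots> = (\<Sum>k\<in>A. (q' k)\<^sup>2 * (1 / (q a k * (1 - q a k))))"
    by (simp add: A_def sum.Sigma finite_edge_pairs case_prod_unfold)
  finally have fisher: "?I = (\<Sum>k\<in>A. (q' k)\<^sup>2 * (1 / (q a k * (1 - q a k))))" .
  have CR: "1 \<le> ?I * ?V"
    unfolding fisher law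
  proof (rule cramer_rao_Pi_bernoulli)
    show "finite A" by (simp add: A_def finite_edge_pairs)
    show "open \<Theta>" using model by (simp add: linear_model_def)
    show "a \<in> \<Theta>" by (rule a)
    show "0 < q b k \<and> q b k < 1" if "b \<in> \<Theta>" "k \<in> A" for b k
      using that linear_model_edge_prob_bounds[OF model] by (auto simp: A_def q_def)
    show "((\<lambda>b. q b k) has_real_derivative q' k) (at a)" if "k \<in> A" for k
      using that linear_model_edge_prob_deriv[OF model a] by (auto simp: A_def q_def q'_def)
    show "unbiased_estimator (\<lambda>b. Pi_pmf A False (\<lambda>i. bernoulli_pmf (q b i))) \<Theta> est"
      using unbiased by (simp flip: law)
  qed
  \<comment> \<open>Positivity is a consequence of the existence of an unbiased estimator: a product
    with a nonnegative variance can reach 1 only if the information is positive. For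
    \<open>T = 0\<close> the information vanishes, so no such estimator exists.\<close>
  have "0 \<le> ?V" by (rule measure_pmf.variance_positive)
  with CR show "0 < ?I"
    by (smt (verit) mult_nonpos_nonneg)
  with CR show "inverse ?I \<le> ?V"
    by (simp add: field_simps)
qed

theorem corollary3:
  shows
   "(\<forall>n d T X0 \<Theta> X \<alpha>\<^sub>0.
        linear_model n d T X0 \<Theta> X \<and> \<alpha>\<^sub>0 \<in> \<Theta> \<longrightarrow>
        fisher_info n T (edge_prob X) \<alpha>\<^sub>0 =
          4 * (\<Sum>t=0..T. (real t)\<^sup>2 * (\<Sum>(i, j)\<in>edge_pairs n.
             edge_prob X \<alpha>\<^sub>0 t $$ (i, j) / (1 - edge_prob X \<alpha>\<^sub>0 t $$ (i, j)))))
    \<and>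
    (\<forall>\<epsilon>>0. \<exists>c>0. \<exists>C>0. \<forall>n d T X0 \<Theta> X \<alpha>\<^sub>0.
        linear_model n d T X0 \<Theta> X \<and> \<alpha>\<^sub>0 \<in> \<Theta> \<and> 1 \<le> T \<and>
        (\<forall>t\<le>T. \<forall>(i, j)\<in>edge_pairs n. edge_prob X \<alpha>\<^sub>0 t $$ (i, j) \<in> {\<epsilon>..1 - \<epsilon>}) \<longrightarrow>
        c * real T ^ 3 * (real n)\<^sup>2 \<le> fisher_info n T (edge_prob X) \<alpha>\<^sub>0 \<and>
        fisher_info n T (edge_prob X) \<alpha>\<^sub>0 \<le> C * real T ^ 3 * (real n)\<^sup>2)
    \<and>
    (\<forall>n d T X0 \<Theta> X \<alpha>\<^sub>0 est.
        linear_model n d T X0 \<Theta> X \<and> \<alpha>\<^sub>0 \<in> \<Theta> \<and>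
        unbiased_estimator (sample_law n T (edge_prob X)) \<Theta> est \<longrightarrow>
        0 < fisher_info n T (edge_prob X) \<alpha>\<^sub>0 \<and>
        measure_pmf.variance (sample_law n T (edge_prob X) \<alpha>\<^sub>0) est
          \<ge> inverse (fisher_info n T (edge_prob X) \<alpha>\<^sub>0))
    \<and>
    (\<forall>\<epsilon>>0. \<exists>c>0. \<forall>n d T X0 \<Theta> X \<alpha>\<^sub>0.
        linear_model n d T X0 \<Theta> X \<and> \<alpha>\<^sub>0 \<in> \<Theta> \<and> 1 \<le> T \<and>
        (\<forall>t\<le>T. \<forall>(i, j)\<in>edge_pairs n. edge_prob X \<alpha>\<^sub>0 t $$ (i, j) \<in> {\<epsilon>..1 - \<epsilon>}) \<longrightarrow>
        inverse (fisher_info n T (edge_prob X) \<alpha>\<^sub>0) \<ge> c * (1 / (real T ^ 3 * (real n)\<^sup>2)) \<and>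
        (\<forall>est. unbiased_estimator (sample_law n T (edge_prob X)) \<Theta> est \<longrightarrow>
           measure_pmf.variance (sample_law n T (edge_prob X) \<alpha>\<^sub>0) est
             \<ge> c * (1 / (real T ^ 3 * (real n)\<^sup>2))))"
proof (intro conjI)
  \<comment> \<open>The constant is the reciprocal of the upper constant
    \<open>4 / \<epsilon>\<close>. Inverting the upper bound requires positive information, which
    follows from the lower bound because \<open>T\<close> and \<open>n\<close> are positive; no
    estimator is involved.\<close>
  have inverse_bound: "\<epsilon> / 4 * (1 / (real T ^ 3 * (real n)\<^sup>2)) \<le> inverse (fisher_info n T (edge_prob X) a)"
    if "0 < \<epsilon>" and model: "linear_model n d T X0 \<Theta> X" and "a \<in> \<Theta>" "1 \<le> T"
      and "\<forall>t\<le>T. \<forall>(i, j)\<in>edge_pairs n. edge_prob X a t $$ (i, j) \<in> {\<epsilon>..1 - \<epsilon>}"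
    for \<epsilon> n d T X0 \<Theta> X a
  proof -
    note bounds = fisher_info_linear_model_bounds[OF that(2,3,1,5)]
    have "0 < \<epsilon> / 3 * real T ^ 3 * (real n)\<^sup>2"
      using that by (auto simp: linear_model_def)
    then have "0 < fisher_info n T (edge_prob X) a"
      using bounds(1) by linarith
    then have "inverse (4 / \<epsilon> * real T ^ 3 * (real n)\<^sup>2) \<le> inverse (fisher_info n T (edge_prob X) a)"
      using bounds(2) by (rule le_imp_inverse_le[rotated])
    then show ?thesis by (simp add: field_simps)
  qed
  show "\<forall>\<epsilon>>0. \<exists>c>0. \<forall>n d T X0 \<Theta> X \<alpha>\<^sub>0.
        linear_model n d T X0 \<Theta> X \<and> \<alpha>\<^sub>0 \<in> \<Theta> \<and> 1 \<le> T \<and>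
        (\<forall>t\<le>T. \<forall>(i, j)\<in>edge_pairs n. edge_prob X \<alpha>\<^sub>0 t $$ (i, j) \<in> {\<epsilon>..1 - \<epsilon>}) \<longrightarrow>
        inverse (fisher_info n T (edge_prob X) \<alpha>\<^sub>0) \<ge> c * (1 / (real T ^ 3 * (real n)\<^sup>2)) \<and>
        (\<forall>est. unbiased_estimator (sample_law n T (edge_prob X)) \<Theta> est \<longrightarrow>
           measure_pmf.variance (sample_law n T (edge_prob X) \<alpha>\<^sub>0) est
             \<ge> c * (1 / (real T ^ 3 * (real n)\<^sup>2)))"
  proof (intro allI impI exI conjI; (elim conjE)?)
    show "0 < \<epsilon> / 4" if "0 < \<epsilon>" for \<epsilon> :: real using that by simp
  qed (fact inverse_bound, rule order_trans[OF inverse_bound cramer_rao_linear_model(2)])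
  show "\<forall>\<epsilon>>0. \<exists>c>0. \<exists>C>0. \<forall>n d T X0 \<Theta> X \<alpha>\<^sub>0.
        linear_model n d T X0 \<Theta> X \<and> \<alpha>\<^sub>0 \<in> \<Theta> \<and> 1 \<le> T \<and>
        (\<forall>t\<le>T. \<forall>(i, j)\<in>edge_pairs n. edge_prob X \<alpha>\<^sub>0 t $$ (i, j) \<in> {\<epsilon>..1 - \<epsilon>}) \<longrightarrow>
        c * real T ^ 3 * (real n)\<^sup>2 \<le> fisher_info n T (edge_prob X) \<alpha>\<^sub>0 \<and>
        fisher_info n T (edge_prob X) \<alpha>\<^sub>0 \<le> C * real T ^ 3 * (real n)\<^sup>2"
  proof (intro allI impI)
    fix \<epsilon> :: real assume \<epsilon>: "0 < \<epsilon>"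
    show "\<exists>c>0. \<exists>C>0. \<forall>n d T X0 \<Theta> X \<alpha>\<^sub>0.
        linear_model n d T X0 \<Theta> X \<and> \<alpha>\<^sub>0 \<in> \<Theta> \<and> 1 \<le> T \<and>
        (\<forall>t\<le>T. \<forall>(i, j)\<in>edge_pairs n. edge_prob X \<alpha>\<^sub>0 t $$ (i, j) \<in> {\<epsilon>..1 - \<epsilon>}) \<longrightarrow>
        c * real T ^ 3 * (real n)\<^sup>2 \<le> fisher_info n T (edge_prob X) \<alpha>\<^sub>0 \<and>
        fisher_info n T (edge_prob X) \<alpha>\<^sub>0 \<le> C * real T ^ 3 * (real n)\<^sup>2"
      using \<epsilon> fisher_info_linear_model_bounds[OF _ _ \<epsilon>]
      by (intro exI[of _ "\<epsilon> / 3"] exI[of _ "4 / \<epsilon>"] conjI allI impI; (elim conjE)?) simp_all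
  qed
  show "\<forall>n d T X0 \<Theta> X \<alpha>\<^sub>0 est.
        linear_model n d T X0 \<Theta> X \<and> \<alpha>\<^sub>0 \<in> \<Theta> \<and>
        unbiased_estimator (sample_law n T (edge_prob X)) \<Theta> est \<longrightarrow>
        0 < fisher_info n T (edge_prob X) \<alpha>\<^sub>0 \<and>
        measure_pmf.variance (sample_law n T (edge_prob X) \<alpha>\<^sub>0) est
          \<ge> inverse (fisher_info n T (edge_prob X) \<alpha>\<^sub>0)"
    by (intro allI impI conjI; elim conjE; erule (2) cramer_rao_linear_model)
qed (use fisher_info_linear_model in blast)

end
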